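(* Let $m,n$ be positive integers, let $\Omega_1,\dots,\Omega_m$ be real skew-symmetric $n\times n$ matrices that are not all equal, let $k>0$, and let $A=(a_{ij})$ be the weighted adjacency matrix of a weighted digraph $\mathcal{G}$ on $\{1,\dots,m\}$. Consider the high-dimensional Kuramoto model with nonidentical oscillators on the unit sphere, $$\dot r_i=\Omega_i r_i+k\sum_{j=1}^m a_{ij}\big(r_j-(r_i^{\mathrm T}r_j)r_i\big),\qquad r_i\in\mathbf{R}^n,\ \|r_i\|=1,\qquad i=1,\dots,m,$$ and let $$W=\bigcap_{l=1}^{n}\{\xi\in\mathbf{R}^n : \Omega_1^l\xi=\Omega_2^l\xi=\cdots=\Omega_m^l\xi\}=\bigcap_{l=1}^{n}\bigcap_{i=2}^m\ker(\Omega_i^l-\Omega_1^l).$$ Assume that $\dim(W)>0$ and that $\mathcal{G}$ is strongly connected. If the initial states satisfy, for some $p\in W$, $p^{\mathrm T}r_i(0)>0$ for every $i=1,2,\dots,m$, then the solution $r(t)=(r_1^{\mathrm T}(t),\dots,r_m^{\mathrm T}(t))^{\mathrm T}$ exhibits complete phase synchronization, and each $r_i(t)$ approaches $W$ as $t\to+\infty$.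
   Context: The weighted adjacency matrix $A=(a_{ij})$ of a weighted digraph on vertices $\{1,\dots,m\}$ with edge set $\mathcal{E}$ satisfies $a_{ij}>0$ if $(j,i)\in\mathcal{E}$ and $a_{ij}=0$ otherwise. The digraph is strongly connected if for any two vertices there is a directed path from each to the other. Each $\|r_i(t)\|$ is constant along solutions, so the unit sphere constraint is preserved by the flow. A solution $r(t)$ is said to exhibit (achieve) complete phase synchronization if $\lim_{t\to+\infty}(r_i(t)-r_j(t))=0$ for all $1\le i,j\le m$. "$r_i(t)$ approaches $W$" means that the Euclidean distance from $r_i(t)$ to $W$ tends to $0$. The norm is Euclidean. *)

theory Defs
  imports "HOL-Analysis.Analysis"
begin

text \<open>Powers with respect to the matrix product; the operation \<open>^\<close> on \<open>real ^ 'n ^ 'n\<close> acts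
  entrywise and is not the matrix power.\<close>

primrec matpow :: "real ^ 'n ^ 'n \<Rightarrow> nat \<Rightarrow> real ^ 'n ^ 'n" where
  "matpow M 0 = mat 1"
| "matpow M (Suc l) = M ** matpow M l"

definition skew_symmetric :: "real ^ 'n ^ 'n \<Rightarrow> bool" where
  "skew_symmetric M \<longleftrightarrow> transpose M = - M"

text \<open>The finite type \<open>'m\<close> is the vertex set and \<open>E\<close> the edge set. Note the orientation: the entry
  in row \<open>i\<close>, column \<open>j\<close> is the weight of the edge from \<open>j\<close> to \<open>i\<close>.\<close>

definition weighted_adjacency_matrix :: "('m \<times> 'm) set \<Rightarrow> real ^ 'm ^ 'm \<Rightarrow> bool" where
  "weighted_adjacency_matrix E A \<longleftrightarrow>
     (\<forall>i j. ((j, i) \<in> E \<longrightarrow> A $ i $ j > 0) \<and> ((j, i) \<notin> E \<longrightarrow> A $ i $ j = 0))"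

definition strongly_connected_digraph :: "('m \<times> 'm) set \<Rightarrow> bool" where
  "strongly_connected_digraph E \<longleftrightarrow> (\<forall>u v. (u, v) \<in> E\<^sup>*)"

text \<open>A solution on \<open>[0, \<infinity>)\<close>, with one-sided derivative at \<open>0\<close>. The unit sphere constraint is
  imposed at time \<open>0\<close> only, since the flow preserves it.\<close>

definition kuramoto_solution ::
  "('m::finite \<Rightarrow> real ^ 'n ^ 'n) \<Rightarrow> real \<Rightarrow> real ^ 'm ^ 'm \<Rightarrow> ('m \<Rightarrow> real \<Rightarrow> real ^ 'n) \<Rightarrow> bool" where
  "kuramoto_solution \<Omega> k A r \<longleftrightarrow>
     (\<forall>i. norm (r i 0) = 1) \<and>
     (\<forall>i. \<forall>t\<ge>0. (r i has_vector_derivative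
        \<Omega> i *v r i t + k *\<^sub>R (\<Sum>j\<in>UNIV. A $ i $ j *\<^sub>R (r j t - (r i t \<bullet> r j t) *\<^sub>R r i t)))
        (at t within {0..}))"

definition common_power_space :: "('m \<Rightarrow> real ^ 'n ^ 'n) \<Rightarrow> (real ^ 'n) set" where
  "common_power_space \<Omega> =
     (\<Inter>l\<in>{1..CARD('n)}. {\<xi>. \<forall>i j. matpow (\<Omega> i) l *v \<xi> = matpow (\<Omega> j) l *v \<xi>})"

definition complete_phase_synchronization :: "('m \<Rightarrow> real \<Rightarrow> real ^ 'n) \<Rightarrow> bool" where
  "complete_phase_synchronization r \<longleftrightarrow> (\<forall>i j. ((\<lambda>t. r i t - r j t) \<longlongrightarrow> 0) at_top)"

definition approaches :: "(real \<Rightarrow> real ^ 'n) \<Rightarrow> (real ^ 'n) set \<Rightarrow> bool" where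
  "approaches x S \<longleftrightarrow> ((\<lambda>t. infdist (x t) S) \<longlongrightarrow> 0) at_top"

end

theory Submission
  imports Defs
begin

text \<open>The first \<open>n\<close> powers already force all powers of the \<open>\<Omega>\<^sub>i\<close> to agree on \<open>p\<close>, so the solution
  \<open>u\<close> of \<open>u' = \<Omega>\<^sub>i u\<close>, \<open>u(0) = p\<close> does not depend on \<open>i\<close>. In this rotating frame
  \<open>x\<^sub>i = u \<bullet> r\<^sub>i\<close> satisfies \<open>x\<^sub>i' = k \<Sum>\<^sub>j a\<^sub>i\<^sub>j (x\<^sub>j - (r\<^sub>i \<bullet> r\<^sub>j) x\<^sub>i)\<close>, a cooperative system, hence stays
  positive. If \<open>w\<close> is a positive left null vector of the graph Laplacian, then
  \<open>L = \<Sum>\<^sub>i w\<^sub>i ln x\<^sub>i\<close> is bounded above and \<open>L' \<ge> (k/2) \<Sum>\<^sub>i\<^sub>j w\<^sub>i a\<^sub>i\<^sub>j \<bar>r\<^sub>i - r\<^sub>j\<bar>\<^sup>2\<close>, because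
  \<open>x\<^sub>j / x\<^sub>i - 1 \<ge> ln x\<^sub>j - ln x\<^sub>i\<close> and the weighted logarithmic differences cancel. Barbalat's lemma
  gives synchronization along edges. Differentiating \<open>\<Omega>\<^sub>i\<^sup>l r\<^sub>i - \<Omega>\<^sub>j\<^sup>l r\<^sub>j \<rightarrow> 0\<close> repeatedly, again by
  Barbalat, gives \<open>(\<Omega>\<^sub>i\<^sup>l - \<Omega>\<^sub>j\<^sup>l) r\<^sub>h \<rightarrow> 0\<close> for all \<open>l\<close>, and compactness of the sphere turns
  this into convergence to the common power space.\<close>

section \<open>Monotonicity and Barbalat arguments on the half-line\<close>

text \<open>After time \<open>0\<close> the derivative within \<open>{0..}\<close> is two-sided, so
  the usual mean value argument applies. The sign is required only strictly inside the interval,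
  which suits a first-exit argument where nothing is known at the exit time.\<close>

lemma has_real_derivative_nonneg_imp_le:
  fixes f :: "real \<Rightarrow> real"
  assumes "0 \<le> a" "a \<le> b"
    and der: "\<And>t. 0 \<le> t \<Longrightarrow> (f has_real_derivative f' t) (at t within {0..})"
    and nonneg: "\<And>t. a < t \<Longrightarrow> t < b \<Longrightarrow> 0 \<le> f' t"
  shows "f a \<le> f b"
proof (rule DERIV_nonneg_imp_increasing_open[OF \<open>a \<le> b\<close>])
  fix t assume t: "a < t" "t < b"
  then have "at t within {0..} = at t"
    using \<open>0 \<le> a\<close> by (intro at_within_interior) (simp add: interior_real_atLeast)
  then show "\<exists>y. DERIV f t :> y \<and> 0 \<le> y"
    using der[of t] nonneg[of t] t \<open>0 \<le> a\<close> by auto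
next
  have "continuous_on {0..} f"
    using der by (intro DERIV_continuous_on) auto
  then show "continuous_on {a..b} f"
    by (rule continuous_on_subset) (use \<open>0 \<le> a\<close> in auto)
qed

lemma mono_bounded_tendsto_at_top:
  fixes f :: "real \<Rightarrow> real"
  assumes mono: "\<And>s t. 0 \<le> s \<Longrightarrow> s \<le> t \<Longrightarrow> f s \<le> f t"
    and bound: "\<And>t. 0 \<le> t \<Longrightarrow> f t \<le> B"
  obtains l where "(f \<longlongrightarrow> l) at_top"
proof
  let ?l = "SUP t\<in>{0..}. f t"
  have bdd: "bdd_above (f ` {0..})"
    using bound by (auto intro!: bdd_aboveI)
  show "(f \<longlongrightarrow> ?l) at_top"
  proof (rule increasing_tendsto)
    show "\<forall>\<^sub>F t in at_top. f t \<le> ?l"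
      using eventually_ge_at_top[of 0] by eventually_elim (auto intro!: cSUP_upper bdd)
    fix x assume "x < ?l"
    then obtain s where "0 \<le> s" "x < f s"
      using less_cSUP_iff[OF _ bdd] by auto
    show "\<forall>\<^sub>F t in at_top. x < f t"
      using eventually_ge_at_top[of s]
      by eventually_elim (use mono \<open>0 \<le> s\<close> \<open>x < f s\<close> in force)
  qed
qed

text \<open>If \<open>h t \<ge> \<epsilon>\<close> at a late time, uniform continuity keeps
  \<open>h\<close> above \<open>3/4 * \<epsilon>\<close> for a further time \<open>\<delta>\<close>.
  There \<open>e\<close> costs less than \<open>\<epsilon> / 4\<close>, so \<open>g\<close> grows by
  at least \<open>\<epsilon> * \<delta> / 2\<close>, contradicting its convergence. The bound on
  \<open>g'\<close> is one-sided because the derivative of the Lyapunov function is estimated only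
  from below.\<close>

lemma barbalat_eventually_less:
  fixes g g' h e :: "real \<Rightarrow> real"
  assumes lim: "(g \<longlongrightarrow> l) at_top"
    and der: "\<And>t. 0 \<le> t \<Longrightarrow> (g has_real_derivative g' t) (at t within {0..})"
    and le: "\<And>t. 0 \<le> t \<Longrightarrow> h t + e t \<le> g' t"
    and e: "(e \<longlongrightarrow> 0) at_top"
    and uc: "uniformly_continuous_on {0..} h"
    and "0 < \<epsilon>"
  shows "\<forall>\<^sub>F t in at_top. h t < \<epsilon>"
proof -
  obtain d where "d > 0" and d: "\<And>s t. 0 \<le> s \<Longrightarrow> 0 \<le> t \<Longrightarrow> dist s t < d \<Longrightarrow> dist (h s) (h t) < \<epsilon> / 4"
    using uc \<open>0 < \<epsilon>\<close> unfolding uniformly_continuous_on_def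
    by (metis atLeast_iff divide_pos_pos zero_less_numeral)
  define \<delta> where "\<delta> = d / 2"
  have "\<delta> > 0" "\<delta> < d" using \<open>d > 0\<close> by (auto simp: \<delta>_def)
  have "\<forall>\<^sub>F t in at_top. dist (e t) 0 < \<epsilon> / 4"
    using e \<open>0 < \<epsilon>\<close> by (intro tendstoD) auto
  then obtain T1 where T1: "\<And>t. t \<ge> T1 \<Longrightarrow> \<bar>e t\<bar> < \<epsilon> / 4"
    by (auto simp: eventually_at_top_linorder)
  \<comment> \<open>Two errors of this size add up to less than the growth
    \<open>\<epsilon> * \<delta> / 2\<close> forced on \<open>g\<close>.\<close>
  have "\<forall>\<^sub>F t in at_top. dist (g t) l < \<epsilon> * \<delta> / 8"
    using lim \<open>0 < \<epsilon>\<close> \<open>\<delta> > 0\<close> by (intro tendstoD) auto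
  then obtain T2 where T2: "\<And>t. t \<ge> T2 \<Longrightarrow> \<bar>g t - l\<bar> < \<epsilon> * \<delta> / 8"
    by (auto simp: eventually_at_top_linorder dist_real_def)
  have "h t < \<epsilon>" if t: "t \<ge> max 0 (max T1 T2)" for t
  proof (rule ccontr)
    assume "\<not> h t < \<epsilon>"
    have "g t - \<epsilon> / 2 * t \<le> g (t + \<delta>) - \<epsilon> / 2 * (t + \<delta>)"
    proof (rule has_real_derivative_nonneg_imp_le[where f = "\<lambda>t. g t - \<epsilon> / 2 * t"])
      show "((\<lambda>t. g t - \<epsilon> / 2 * t) has_real_derivative g' s - \<epsilon> / 2) (at s within {0..})"
        if "0 \<le> s" for s
        using der[OF that] by (auto intro!: derivative_eq_intros)
      fix s assume s: "t < s" "s < t + \<delta>"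
      then have "\<bar>h s - h t\<bar> < \<epsilon> / 4"
        using d[of s t] t \<open>\<delta> < d\<close> by (auto simp: dist_real_def)
      then show "0 \<le> g' s - \<epsilon> / 2"
        using le[of s] T1[of s] s t \<open>\<not> h t < \<epsilon>\<close> by linarith
    qed (use t \<open>\<delta> > 0\<close> in auto)
    then have "\<epsilon> * \<delta> / 2 \<le> g (t + \<delta>) - g t"
      by (simp add: distrib_left)
    moreover have "\<bar>g t - l\<bar> < \<epsilon> * \<delta> / 8" "\<bar>g (t + \<delta>) - l\<bar> < \<epsilon> * \<delta> / 8"
      using T2 t \<open>\<delta> > 0\<close> by auto
    moreover have "\<epsilon> * \<delta> > 0" using \<open>0 < \<epsilon>\<close> \<open>\<delta> > 0\<close> by simp
    ultimately show False by linarith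
  qed
  then show ?thesis
    unfolding eventually_at_top_linorder by blast
qed

text \<open>The one-sided version applies to \<open>g\<close> and to \<open>- g\<close>. The
  perturbation \<open>e\<close> will stand for the coupling terms, which enter only through their
  limit.\<close>

lemma barbalat_tendsto_zero:
  fixes g h e :: "real \<Rightarrow> real"
  assumes lim: "(g \<longlongrightarrow> l) at_top"
    and der: "\<And>t. 0 \<le> t \<Longrightarrow> (g has_real_derivative h t + e t) (at t within {0..})"
    and e: "(e \<longlongrightarrow> 0) at_top"
    and uc: "uniformly_continuous_on {0..} h"
  shows "(h \<longlongrightarrow> 0) at_top"
proof (rule tendstoI)
  fix \<epsilon> :: real assume "0 < \<epsilon>"
  have "\<forall>\<^sub>F t in at_top. h t < \<epsilon>"
    by (rule barbalat_eventually_less[OF lim der _ e uc \<open>0 < \<epsilon>\<close>]) auto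
  moreover have "\<forall>\<^sub>F t in at_top. - h t < \<epsilon>"
  proof (rule barbalat_eventually_less[OF _ _ _ _ _ \<open>0 < \<epsilon>\<close>])
    show "((\<lambda>t. - g t) has_real_derivative - (h t + e t)) (at t within {0..})" if "0 \<le> t" for t
      using der[OF that] by (rule DERIV_minus)
    show "((\<lambda>t. - g t) \<longlongrightarrow> - l) at_top" "((\<lambda>t. - e t) \<longlongrightarrow> 0) at_top"
      using tendsto_minus[OF lim] tendsto_minus[OF e] by simp_all
    show "uniformly_continuous_on {0..} (\<lambda>t. - h t)"
      using uc by (rule uniformly_continuous_on_minus)
  qed auto
  ultimately show "\<forall>\<^sub>F t in at_top. dist (h t) 0 < \<epsilon>"
    by eventually_elim (auto simp: abs_less_iff)
qed

section \<open>Linear and cooperative differential equations\<close>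

text \<open>Gronwall's argument: with \<open>C\<close> a bound of \<open>c\<close> in absolute value
  on \<open>{0..t}\<close>, the square of \<open>s\<close> times
  \<open>exp (- 2 * C * \<tau>)\<close> is nonincreasing in \<open>\<tau>\<close>, and it starts at
  \<open>0\<close>.\<close>

lemma linear_ode_zero:
  fixes s c :: "real \<Rightarrow> real"
  assumes der: "\<And>t. 0 \<le> t \<Longrightarrow> (s has_real_derivative c t * s t) (at t within {0..})"
    and cont: "continuous_on {0..} c"
    and "s 0 = 0" "0 \<le> t"
  shows "s t = 0"
proof -
  have "compact (c ` {0..t})"
    by (intro compact_continuous_image continuous_on_subset[OF cont]) auto
  then have "bounded (c ` {0..t})" by (rule compact_imp_bounded)
  then obtain C where C: "\<And>\<tau>. 0 \<le> \<tau> \<Longrightarrow> \<tau> \<le> t \<Longrightarrow> \<bar>c \<tau>\<bar> \<le> C"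
    unfolding bounded_iff by (metis atLeastAtMost_iff imageI real_norm_def)
  have "- ((s 0)\<^sup>2 * exp (- 2 * C * 0)) \<le> - ((s t)\<^sup>2 * exp (- 2 * C * t))"
  proof (rule has_real_derivative_nonneg_imp_le[where f = "\<lambda>\<tau>. - ((s \<tau>)\<^sup>2 * exp (- 2 * C * \<tau>))"])
    show "((\<lambda>\<tau>. - ((s \<tau>)\<^sup>2 * exp (- 2 * C * \<tau>))) has_real_derivative
        2 * (C - c \<tau>) * (s \<tau>)\<^sup>2 * exp (- 2 * C * \<tau>)) (at \<tau> within {0..})" if "0 \<le> \<tau>" for \<tau>
      using der[OF that]
      by (auto intro!: derivative_eq_intros simp: algebra_simps power2_eq_square)
    show "0 \<le> 2 * (C - c \<tau>) * (s \<tau>)\<^sup>2 * exp (- 2 * C * \<tau>)" if "0 < \<tau>" "\<tau> < t" for \<tau>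
      using C[of \<tau>] that by (intro mult_nonneg_nonneg) auto
  qed (use \<open>0 \<le> t\<close> in auto)
  then have "(s t)\<^sup>2 * exp (- 2 * C * t) \<le> 0"
    using \<open>s 0 = 0\<close> by simp
  then show ?thesis
    by (simp add: mult_le_0_iff)
qed

text \<open>There would be a first time at which some component \<open>x j\<close> is nonpositive.
  Before it all components are positive, so \<open>x j s * exp (C * s)\<close> is nondecreasing and
  cannot fall from its positive initial value to \<open>0\<close>.\<close>

lemma cooperative_linear_system_pos:
  fixes x :: "'m::finite \<Rightarrow> real \<Rightarrow> real"
  assumes der: "\<And>i t. 0 \<le> t \<Longrightarrow>
      (x i has_real_derivative (\<Sum>j\<in>UNIV. b i j * x j t) - c i t * x i t) (at t within {0..})"
    and b: "\<And>i j. 0 \<le> b i j"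
    and c: "\<And>i t. 0 \<le> t \<Longrightarrow> c i t \<le> C"
    and init: "\<And>i. 0 < x i 0"
    and "0 \<le> t"
  shows "0 < x i t"
proof (rule ccontr)
  assume "\<not> 0 < x i t"
  define S where "S = (\<Union>i. {t \<in> {0..}. x i t \<le> 0})"
  have cont: "continuous_on {0..} (x i)" for i
    using der by (intro DERIV_continuous_on) auto
  have "closed S"
    unfolding S_def using cont
    by (intro closed_UN ballI continuous_on_closed_Collect_le) auto
  moreover have ne: "S \<noteq> {}"
    using \<open>\<not> 0 < x i t\<close> \<open>0 \<le> t\<close> by (auto simp: S_def not_less)
  moreover have bdd: "bdd_below S"
    by (rule bdd_belowI[of _ 0]) (auto simp: S_def)
  ultimately have "Inf S \<in> S"
    by (intro closed_contains_Inf)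
  then obtain j where j: "x j (Inf S) \<le> 0" and "0 \<le> Inf S"
    by (auto simp: S_def)
  have pos: "0 < x i s" if "0 \<le> s" "s < Inf S" for i s
  proof (rule ccontr)
    assume "\<not> 0 < x i s"
    then have "s \<in> S" using \<open>0 \<le> s\<close> by (auto simp: S_def not_less)
    then show False using cInf_lower[OF _ bdd, of s] \<open>s < Inf S\<close> by simp
  qed
  have "x j 0 * exp (C * 0) \<le> x j (Inf S) * exp (C * Inf S)"
  proof (rule has_real_derivative_nonneg_imp_le[where f = "\<lambda>s. x j s * exp (C * s)"])
    show "((\<lambda>s. x j s * exp (C * s)) has_real_derivative
        ((\<Sum>i\<in>UNIV. b j i * x i s) + (C - c j s) * x j s) * exp (C * s)) (at s within {0..})"
      if "0 \<le> s" for s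
      using der[OF that, of j] by (auto intro!: derivative_eq_intros simp: algebra_simps)
    show "0 \<le> ((\<Sum>i\<in>UNIV. b j i * x i s) + (C - c j s) * x j s) * exp (C * s)"
      if "0 < s" "s < Inf S" for s
      using that pos[of s] b c[of s j]
      by (intro mult_nonneg_nonneg add_nonneg_nonneg sum_nonneg) (auto simp: less_imp_le)
  qed (use \<open>0 \<le> Inf S\<close> in auto)
  moreover have "x j (Inf S) * exp (C * Inf S) \<le> 0"
    using j by (simp add: mult_le_0_iff)
  ultimately show False
    using init[of j] by simp
qed

section \<open>Approaching the zero set of a continuous function\<close>

text \<open>The points of \<open>K\<close> at distance at least \<open>\<epsilon>\<close> from
  \<open>S\<close> form a compact set on which \<open>G\<close> is positive. Unless this set is
  empty, \<open>G\<close> has a positive minimum there, and \<open>G (x t)\<close> eventually falls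
  below it.\<close>

lemma infdist_zero_set_tendsto_zero:
  fixes G :: "'a::heine_borel \<Rightarrow> real"
  assumes "compact K" "continuous_on K G" "\<And>x. x \<in> K \<Longrightarrow> 0 \<le> G x"
    and S: "\<And>x. x \<in> K \<Longrightarrow> G x = 0 \<Longrightarrow> x \<in> S"
    and x: "\<forall>\<^sub>F t in F. x t \<in> K"
    and lim: "((\<lambda>t. G (x t)) \<longlongrightarrow> 0) F"
  shows "((\<lambda>t. infdist (x t) S) \<longlongrightarrow> 0) F"
proof (rule tendstoI)
  fix \<epsilon> :: real assume "0 < \<epsilon>"
  define Q where "Q = K \<inter> {y. \<epsilon> \<le> infdist y S}"
  have "compact Q"
    unfolding Q_def
    by (intro compact_Int_closed \<open>compact K\<close> closed_Collect_le continuous_intros)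
  show "\<forall>\<^sub>F t in F. dist (infdist (x t) S) 0 < \<epsilon>"
  proof (cases "Q = {}")
    case True
    show ?thesis
      using x by eventually_elim (use True in \<open>force simp: Q_def infdist_nonneg\<close>)
  next
    case False
    have "continuous_on Q G"
      by (rule continuous_on_subset[OF assms(2)]) (auto simp: Q_def)
    then obtain q where q: "q \<in> Q" "\<And>y. y \<in> Q \<Longrightarrow> G q \<le> G y"
      using continuous_attains_inf[OF \<open>compact Q\<close> False] by blast
    have "G q \<noteq> 0"
      using q(1) S[of q] \<open>0 < \<epsilon>\<close> by (auto simp: Q_def)
    then have "0 < G q"
      using assms(3)[of q] q(1) by (auto simp: Q_def)
    then have "\<forall>\<^sub>F t in F. dist (G (x t)) 0 < G q"
      using lim by (intro tendstoD)
    then show ?thesis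
      using x
    proof eventually_elim
      case (elim t)
      then have "x t \<notin> Q" using q(2)[of "x t"] by auto
      then show ?case using elim by (auto simp: Q_def infdist_nonneg)
    qed
  qed
qed

section \<open>Positive left null vector of the graph Laplacian\<close>

text \<open>Brouwer's theorem on the probability simplex gives a fixed point of a small step of the
  Markov flow with rates \<open>A\<close>, which is a stationary distribution. Strong connectivity
  makes all its entries positive.\<close>

lemma laplacian_positive_left_null_vector:
  fixes A :: "real ^ 'm::finite ^ 'm"
  assumes A: "weighted_adjacency_matrix E A" and E: "strongly_connected_digraph E"
  obtains w :: "'m \<Rightarrow> real" where "\<And>i. 0 < w i"
    "\<And>j. (\<Sum>i\<in>UNIV. w i * A $ i $ j) = w j * (\<Sum>i\<in>UNIV. A $ j $ i)"
proof -
  have nonneg: "0 \<le> A $ i $ j" for i j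
    using A by (cases "(j, i) \<in> E") (auto simp: weighted_adjacency_matrix_def less_imp_le)
  define d where "d j = (\<Sum>i\<in>UNIV. A $ j $ i)" for j
  \<comment> \<open>The step size \<open>1 / M\<close> is so small that the outflow
    \<open>v $ j * d j / M\<close> never exceeds \<open>v $ j\<close>. The summand \<open>1\<close>
    keeps \<open>M\<close> positive when all rates vanish.\<close>
  define M where "M = 1 + (\<Sum>j\<in>UNIV. d j)"
  have d: "0 \<le> d j" for j using nonneg by (simp add: d_def sum_nonneg)
  have dM: "d j \<le> M" for j
    using member_le_sum[of j UNIV d] d by (simp add: M_def)
  have "M > 0" using d by (simp add: M_def sum_nonneg add_pos_nonneg)
  define S where "S = {v :: real ^ 'm. (\<forall>i. 0 \<le> v $ i) \<and> (\<Sum>i\<in>UNIV. v $ i) = 1}"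
  define f where "f v = (\<chi> j. v $ j + ((\<Sum>i\<in>UNIV. v $ i * A $ i $ j) - v $ j * d j) / M)"
    for v :: "real ^ 'm"
  have "compact S"
  proof (rule compact_eq_bounded_closed[THEN iffD2], intro conjI)
    have "norm v \<le> 1" if "v \<in> S" for v
      using norm_le_l1_cart[of v] that by (simp add: S_def)
    then show "bounded S" by (auto simp: bounded_iff)
    show "closed S"
      unfolding S_def
      by (intro closed_Collect_conj closed_Collect_all closed_Collect_le closed_Collect_eq
          continuous_intros)
  qed
  moreover have "convex S"
    unfolding S_def
    by (rule convexI) (auto simp: sum.distrib simp flip: sum_distrib_left)
  moreover have "axis undefined 1 \<in> S"
    by (simp add: S_def axis_def)
  moreover have "continuous_on S f"
    unfolding f_def by (intro continuous_intros) (use \<open>M > 0\<close> in auto)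
  moreover have "f \<in> S \<rightarrow> S"
  proof
    fix v assume v: "v \<in> S"
    have "0 \<le> f v $ j" for j
    proof -
      have "v $ j * d j \<le> v $ j * M"
        using v dM by (intro mult_left_mono) (auto simp: S_def)
      moreover have "0 \<le> (\<Sum>i\<in>UNIV. v $ i * A $ i $ j)"
        using v nonneg by (intro sum_nonneg mult_nonneg_nonneg) (auto simp: S_def)
      ultimately show ?thesis
        using \<open>M > 0\<close> by (simp add: f_def field_simps)
    qed
    \<comment> \<open>Total inflow equals total outflow, so \<open>f\<close> preserves the
      coordinate sum.\<close>
    moreover have "(\<Sum>j\<in>UNIV. \<Sum>i\<in>UNIV. v $ i * A $ i $ j) = (\<Sum>i\<in>UNIV. v $ i * d i)"
      by (subst sum.swap) (simp add: d_def sum_distrib_left)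
    then have "(\<Sum>j\<in>UNIV. f v $ j) = 1"
      using v by (simp add: f_def S_def sum.distrib sum_subtractf flip: sum_divide_distrib)
    ultimately show "f v \<in> S" by (simp add: S_def)
  qed
  ultimately obtain v where v: "v \<in> S" "f v = v"
    using brouwer[of S f] by blast
  have eq: "(\<Sum>i\<in>UNIV. v $ i * A $ i $ j) = v $ j * (\<Sum>i\<in>UNIV. A $ j $ i)" for j
  proof -
    have "f v $ j = v $ j" using v(2) by simp
    then show ?thesis using \<open>M > 0\<close> by (simp add: f_def d_def)
  qed
  have "0 < v $ j" for j
  proof (rule ccontr)
    assume "\<not> 0 < v $ j"
    then have "v $ j = 0" using v(1) by (auto simp: S_def not_less intro: antisym)
    \<comment> \<open>A zero entry spreads along edges: if \<open>v $ y = 0\<close>, the nonnegative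
      terms of the inflow to \<open>y\<close> all vanish, and an edge from \<open>y\<close> to
      \<open>z\<close> makes the weight \<open>A $ z $ y\<close> positive.\<close>
    have "v $ i = 0" if "(j, i) \<in> E\<^sup>*" for i
      using that
    proof induction
      case (step y z)
      then have "(\<Sum>i\<in>UNIV. v $ i * A $ i $ y) = 0"
        by (simp add: eq)
      moreover have "0 \<le> v $ i * A $ i $ y" for i
        using v(1) nonneg by (auto simp: S_def)
      ultimately have "v $ z * A $ z $ y = 0"
        by (simp add: sum_nonneg_eq_0_iff)
      moreover have "A $ z $ y > 0"
        using A step by (auto simp: weighted_adjacency_matrix_def)
      ultimately show ?case by simp
    qed (fact \<open>v $ j = 0\<close>)
    then have "(\<Sum>i\<in>UNIV. v $ i) = 0"
      using E by (simp add: strongly_connected_digraph_def)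
    then show False using v(1) by (simp add: S_def)
  qed
  then show ?thesis using eq by (rule that)
qed

section \<open>Matrix powers and linear flows\<close>

lemma matpow_Suc_mult_vector: "matpow M (Suc l) *v x = M *v (matpow M l *v x)"
  by (simp add: matrix_vector_mul_assoc)

text \<open>Of the vectors \<open>M\<^sup>l \<xi>\<close> with \<open>l \<le> n\<close> one depends on its predecessors, so the first
  \<open>n\<close> powers already determine the whole orbit.\<close>

lemma common_power_space_matpow_eq:
  fixes \<Omega> :: "'m \<Rightarrow> real ^ 'n ^ 'n"
  assumes "\<xi> \<in> common_power_space \<Omega>"
  shows "matpow (\<Omega> i) l *v \<xi> = matpow (\<Omega> j) l *v \<xi>"
proof -
  define s where "s l = matpow (\<Omega> j) l *v \<xi>" for l
  have s_Suc: "s (Suc l) = \<Omega> j *v s l" for l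
    by (simp add: s_def matpow_Suc_mult_vector del: matpow.simps)
  have eq_s: "matpow (\<Omega> i) l *v \<xi> = s l" if "l \<le> CARD('n)" for l
  proof (cases l)
    case (Suc l')
    then show ?thesis
      using assms that by (auto simp: common_power_space_def s_def simp del: matpow.simps)
  qed (simp add: s_def)
  \<comment> \<open>The vectors \<open>s 0\<close> to \<open>s n\<close>, with
    \<open>n = CARD('n)\<close>, are one too many to be independent, so a dependent one occurs at an
    index \<open>d \<le> n\<close>.\<close>
  obtain d where d: "d \<le> CARD('n)" "s d \<in> span (s ` {..<d})"
  proof (rule ccontr)
    assume "\<not> thesis"
    with that have indep: "s d \<notin> span (s ` {..<d})" if "d \<le> CARD('n)" for d
      using that by blast
    have "independent (s ` {..<d}) \<and> card (s ` {..<d}) = d" if "d \<le> Suc CARD('n)" for d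
      using that
    proof (induction d)
      case (Suc d)
      then have "s d \<notin> s ` {..<d}"
        using indep[of d] span_base[of "s d" "s ` {..<d}"] by auto
      then show ?case
        using Suc indep[of d] by (simp add: lessThan_Suc independent_insertI)
    qed (simp add: independent_empty)
    from this[of "Suc CARD('n)"] show False
      using independent_bound[of "s ` {..<Suc CARD('n)}"] by simp
  qed
  let ?K = "span (s ` {..<d})"
  have "\<Omega> j *v x \<in> ?K" if "x \<in> ?K" for x
  proof -
    have "\<Omega> j *v x \<in> (*v) (\<Omega> j) ` ?K" using that by simp
    also have "\<dots> = span ((*v) (\<Omega> j) ` s ` {..<d})"
      by (simp add: linear_span_image)
    also have "\<dots> \<subseteq> ?K"
    proof (rule span_minimal)
      have "s (Suc l) \<in> ?K" if "l < d" for l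
        using that d(2) span_base[of "s (Suc l)" "s ` {..<d}"]
        by (cases "Suc l = d") auto
      then show "(*v) (\<Omega> j) ` s ` {..<d} \<subseteq> ?K"
        by (auto simp: s_Suc)
    qed (rule subspace_span)
    finally show ?thesis .
  qed
  then have K: "s l \<in> ?K" for l
  proof (induction l)
    case 0
    then show ?case
      using d(2) span_base[of "s 0" "s ` {..<d}"] by (cases "d = 0") auto
  qed (simp add: s_Suc)
  \<comment> \<open>On a generator \<open>s l\<close> with \<open>l < d\<close> both matrices
    produce the power \<open>l + 1\<close> applied to \<open>\<xi>\<close>. Since
    \<open>l + 1 \<le> d \<le> CARD('n)\<close>, the assumption on \<open>\<xi>\<close> just covers
    this power.\<close>
  have "\<Omega> i *v x = \<Omega> j *v x" if "x \<in> ?K" for x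
  proof (rule linear_eq_on[OF _ _ that])
    fix x assume "x \<in> s ` {..<d}"
    then obtain l where l: "l < d" "x = s l" by auto
    then have "\<Omega> i *v x = matpow (\<Omega> i) (Suc l) *v \<xi>"
      using d(1) eq_s[of l] by (simp add: matpow_Suc_mult_vector del: matpow.simps)
    also have "\<dots> = \<Omega> j *v x"
      using l d(1) eq_s[of "Suc l"] by (simp add: s_Suc del: matpow.simps)
    finally show "\<Omega> i *v x = \<Omega> j *v x" .
  qed auto
  then have "matpow (\<Omega> i) l *v \<xi> = s l"
    using K by (induction l) (simp_all add: s_Suc matpow_Suc_mult_vector del: matpow.simps,
        simp add: s_def)
  then show ?thesis by (simp add: s_def)
qed

text \<open>The flow is the matrix exponential applied to \<open>p\<close>, built as a power series
  in each coordinate. The last conclusion holds term by term in the series; applied to differences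
  of the \<open>\<Omega> i\<close>, it makes one flow serve all oscillators.\<close>

lemma linear_flow_exists:
  fixes M :: "real ^ 'n ^ 'n" and p :: "real ^ 'n"
  obtains u where "u 0 = p" "\<And>t. (u has_vector_derivative M *v u t) (at t)"
    "\<And>N :: real ^ 'n ^ 'n. \<And>t. (\<And>l. N *v (matpow M l *v p) = 0) \<Longrightarrow> N *v u t = 0"
proof -
  define c where "c a l = (matpow M l *v p) $ a / fact l" for a l
  define u where "u t = (\<chi> a. \<Sum>l. c a l * t ^ l)" for t
  obtain B where "B > 0" and B: "\<And>x. norm (M *v x) \<le> norm x * B"
    using bounded_linear.pos_bounded[OF matrix_vector_mul_bounded_linear[of M]] by blast
  have norm_le: "norm (matpow M l *v p) \<le> B ^ l * norm p" for l
  proof (induction l)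
    case (Suc l)
    have "norm (matpow M (Suc l) *v p) \<le> B * norm (matpow M l *v p)"
      using B[of "matpow M l *v p"]
      by (simp add: matpow_Suc_mult_vector mult.commute del: matpow.simps)
    also have "\<dots> \<le> B * (B ^ l * norm p)"
      using Suc \<open>B > 0\<close> by (intro mult_left_mono) auto
    finally show ?case by (simp del: matpow.simps)
  qed simp
  have summable: "summable (\<lambda>l. c a l * t ^ l)" for a t
  proof (rule summable_comparison_test'[of "\<lambda>l. norm p * (inverse (fact l) * (B * \<bar>t\<bar>) ^ l)" 0])
    show "summable (\<lambda>l. norm p * (inverse (fact l) * (B * \<bar>t\<bar>) ^ l))"
      by (intro summable_mult summable_exp)
    fix l :: nat
    have "\<bar>(matpow M l *v p) $ a\<bar> \<le> B ^ l * norm p"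
      using component_le_norm_cart[of "matpow M l *v p" a] norm_le[of l] by linarith
    then have "\<bar>(matpow M l *v p) $ a\<bar> * (\<bar>t\<bar> ^ l / fact l) \<le> B ^ l * norm p * (\<bar>t\<bar> ^ l / fact l)"
      by (intro mult_right_mono) auto
    then show "norm (c a l * t ^ l) \<le> norm p * (inverse (fact l) * (B * \<bar>t\<bar>) ^ l)"
      by (simp add: c_def abs_mult power_abs power_mult_distrib field_simps)
  qed
  \<comment> \<open>Used twice: \<open>N = M\<close> identifies the differentiated series, and an
    \<open>N\<close> that kills all coefficients kills \<open>u t\<close>.\<close>
  have mult_u: "(N *v u t) $ a = (\<Sum>l. (N *v (matpow M l *v p)) $ a / fact l * t ^ l)"
    for N :: "real ^ 'n ^ 'n" and a t
  proof -
    have "(N *v u t) $ a = (\<Sum>b\<in>UNIV. \<Sum>l. N $ a $ b * (c b l * t ^ l))"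
      by (simp add: matrix_vector_mult_def u_def suminf_mult summable)
    also have "\<dots> = (\<Sum>l. \<Sum>b\<in>UNIV. N $ a $ b * (c b l * t ^ l))"
      by (intro suminf_sum[symmetric] summable_mult summable)
    also have "(\<lambda>l. \<Sum>b\<in>UNIV. N $ a $ b * (c b l * t ^ l)) =
        (\<lambda>l. (N *v (matpow M l *v p)) $ a / fact l * t ^ l)"
      unfolding matrix_vector_mult_def[of N] c_def
      by (simp add: sum_divide_distrib sum_distrib_right mult.assoc)
    finally show ?thesis .
  qed
  show thesis
  proof (rule that)
    show "u 0 = p"
      using powser_zero[of "c _"] by (simp add: u_def vec_eq_iff) (simp add: c_def)
    show "(u has_vector_derivative M *v u t) (at t)" for t
    proof -
      have "((\<lambda>t. u t $ a) has_real_derivative (M *v u t) $ a) (at t)" for a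
      proof -
        have "diffs (c a) = (\<lambda>l. (M *v (matpow M l *v p)) $ a / fact l)"
          by (auto simp: diffs_def c_def fun_eq_iff matpow_Suc_mult_vector simp del: matpow.simps)
        then show ?thesis
          using termdiffs_strong_converges_everywhere[OF summable, of a t]
          unfolding mult_u by (simp add: u_def)
      qed
      then have "((\<lambda>t. u t $ a) has_derivative (\<lambda>h. (h *\<^sub>R (M *v u t)) $ a)) (at t)" for a
        by (simp add: has_field_derivative_def mult_commute_abs)
      then show ?thesis
        unfolding has_vector_derivative_def
        by (subst has_derivative_componentwise_within)
          (auto simp: Basis_vec_def inner_axis)
    qed
    show "N *v u t = 0" if "\<And>l. N *v (matpow M l *v p) = 0"
      for N :: "real ^ 'n ^ 'n" and t
      by (simp add: vec_eq_iff[of "N *v u t"] mult_u that)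
  qed
qed

section \<open>Skew symmetry and geometry of the unit sphere\<close>

lemma skew_symmetric_inner:
  assumes "skew_symmetric M"
  shows "x \<bullet> (M *v y) = - ((M *v x) \<bullet> y)"
proof -
  have "x \<bullet> (M *v y) = (transpose M *v x) \<bullet> y"
    by (simp add: dot_lmul_matrix)
  also have "\<dots> = (- M *v x) \<bullet> y"
    using assms by (simp add: skew_symmetric_def)
  also have "- M *v x = - (M *v x)"
    by (simp add: matrix_vector_mult_def vec_eq_iff sum_negf)
  finally show ?thesis by simp
qed

lemma matpow_commute: "matpow M l *v (M *v x) = M *v (matpow M l *v x)"
  by (induction l) (simp_all add: matpow_Suc_mult_vector del: matpow.simps(2))

text \<open>Split the vector into \<open>y - x\<close> and
  \<open>(1 - x \<bullet> y) *\<^sub>R x\<close>; for unit vectors \<open>1 - x \<bullet> y\<close>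
  is half the squared distance. Hence the coupling vanishes as the oscillators synchronize.\<close>

lemma norm_sub_inner_scaleR_le:
  assumes "norm x = 1" "norm y = 1"
  shows "norm (y - (x \<bullet> y) *\<^sub>R x) \<le> norm (x - y) + (norm (x - y))\<^sup>2 / 2"
proof -
  have eq: "1 - x \<bullet> y = (norm (x - y))\<^sup>2 / 2"
    using assms by (simp add: power2_norm_eq_inner inner_diff inner_commute norm_eq_1)
  have "y - (x \<bullet> y) *\<^sub>R x = (y - x) + (1 - x \<bullet> y) *\<^sub>R x"
    by (simp add: algebra_simps)
  also have "norm \<dots> \<le> norm (y - x) + norm ((1 - x \<bullet> y) *\<^sub>R x)"
    by (rule norm_triangle_ineq)
  also have "\<dots> = norm (x - y) + (norm (x - y))\<^sup>2 / 2"
    using assms by (simp add: eq norm_minus_commute)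
  finally show ?thesis .
qed

section \<open>The Kuramoto flow on the sphere\<close>

locale kuramoto =
  fixes \<Omega> :: "'m::finite \<Rightarrow> real ^ 'n ^ 'n"
    and k :: real
    and E :: "('m \<times> 'm) set"
    and A :: "real ^ 'm ^ 'm"
    and r :: "'m \<Rightarrow> real \<Rightarrow> real ^ 'n"
  assumes skew: "\<And>i. skew_symmetric (\<Omega> i)"
    and k_pos: "k > 0"
    and adj: "weighted_adjacency_matrix E A"
    and strong: "strongly_connected_digraph E"
    and sol: "kuramoto_solution \<Omega> k A r"
begin

lemma A_nonneg: "0 \<le> A $ i $ j"
  using adj by (cases "(j, i) \<in> E") (auto simp: weighted_adjacency_matrix_def less_imp_le)

definition coupling :: "'m \<Rightarrow> real \<Rightarrow> real ^ 'n" where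
  "coupling i t = k *\<^sub>R (\<Sum>j\<in>UNIV. A $ i $ j *\<^sub>R (r j t - (r i t \<bullet> r j t) *\<^sub>R r i t))"

lemma deriv_r:
  "0 \<le> t \<Longrightarrow> (r i has_vector_derivative \<Omega> i *v r i t + coupling i t) (at t within {0..})"
  using sol by (simp add: kuramoto_solution_def coupling_def)

lemma continuous_on_r: "continuous_on {0..} (r i)"
  unfolding continuous_on_eq_continuous_within
  by (metis atLeast_iff deriv_r has_vector_derivative_continuous)

text \<open>The defect \<open>r i t \<bullet> r i t - 1\<close> solves a homogeneous linear
  equation: the rotation drops out by skew symmetry, and the coupling contributes a continuous
  multiple of the defect.\<close>

lemma norm_r:
  assumes "0 \<le> t"
  shows "norm (r i t) = 1"
proof -
  have "r i t \<bullet> r i t - 1 = 0"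
  proof (rule linear_ode_zero[where s = "\<lambda>t. r i t \<bullet> r i t - 1"])
    fix t :: real assume "0 \<le> t"
    have "((\<lambda>t. r i t \<bullet> r i t - 1) has_real_derivative
        2 * (r i t \<bullet> (\<Omega> i *v r i t + coupling i t))) (at t within {0..})"
      using has_vector_derivative_diff_const[THEN iffD2,
          OF bounded_bilinear.has_vector_derivative[OF bounded_bilinear_inner
            deriv_r[OF \<open>0 \<le> t\<close>] deriv_r[OF \<open>0 \<le> t\<close>], of i i], of 1]
      by (simp add: has_real_derivative_iff_has_vector_derivative inner_commute)
    moreover have "r i t \<bullet> (\<Omega> i *v r i t) = 0"
      using skew_symmetric_inner[OF skew, of "r i t" i "r i t"] by (simp add: inner_commute)
    moreover have "2 * (r i t \<bullet> coupling i t) =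
        - 2 * k * (\<Sum>j\<in>UNIV. A $ i $ j * (r i t \<bullet> r j t)) * (r i t \<bullet> r i t - 1)"
      by (simp add: coupling_def inner_sum_right sum_distrib_left sum_distrib_right
          algebra_simps sum_subtractf)
    ultimately show "((\<lambda>t. r i t \<bullet> r i t - 1) has_real_derivative
        - 2 * k * (\<Sum>j\<in>UNIV. A $ i $ j * (r i t \<bullet> r j t)) * (r i t \<bullet> r i t - 1))
        (at t within {0..})"
      by (simp add: inner_add_right)
  next
    show "continuous_on {0..} (\<lambda>t. - 2 * k * (\<Sum>j\<in>UNIV. A $ i $ j * (r i t \<bullet> r j t)))"
      by (intro continuous_intros continuous_on_r)
    show "r i 0 \<bullet> r i 0 - 1 = 0"
      using sol by (simp add: kuramoto_solution_def norm_eq_1)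
  qed (rule assms)
  then show ?thesis by (simp add: norm_eq_1)
qed

lemma inner_r_le: "0 \<le> t \<Longrightarrow> \<bar>r i t \<bullet> r j t\<bar> \<le> 1"
  using Cauchy_Schwarz_ineq2[of "r i t" "r j t"] norm_r[of t i] norm_r[of t j] by simp

text \<open>On the unit sphere the vector field is bounded, so solutions are Lipschitz. This
  supplies the uniform continuity in both uses of Barbalat's lemma.\<close>

lemma uniformly_continuous_on_r: "uniformly_continuous_on {0..} (r i)"
proof -
  obtain B where "B > 0" and B: "\<And>x. norm (\<Omega> i *v x) \<le> norm x * B"
    using bounded_linear.pos_bounded[OF matrix_vector_mul_bounded_linear[of "\<Omega> i"]] by blast
  define C where "C = B + k * (\<Sum>j\<in>UNIV. A $ i $ j * 2)"
  have bound: "norm (\<Omega> i *v r i t + coupling i t) \<le> C" if "0 \<le> t" for t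
  proof -
    have "norm (A $ i $ j *\<^sub>R (r j t - (r i t \<bullet> r j t) *\<^sub>R r i t)) \<le> A $ i $ j * 2" for j
    proof -
      have "norm (r j t - (r i t \<bullet> r j t) *\<^sub>R r i t) \<le> 2"
        using norm_triangle_ineq4[of "r j t" "(r i t \<bullet> r j t) *\<^sub>R r i t"] inner_r_le[OF that, of i j]
        by (simp add: norm_r that)
      then show ?thesis using A_nonneg by (simp add: mult_left_mono)
    qed
    then have "norm (coupling i t) \<le> k * (\<Sum>j\<in>UNIV. A $ i $ j * 2)"
      using k_pos unfolding coupling_def by (simp add: sum_norm_le mult_left_mono)
    moreover have "norm (\<Omega> i *v r i t) \<le> B"
      using B[of "r i t"] that by (simp add: norm_r)
    ultimately show ?thesis
      unfolding C_def by (intro norm_triangle_le add_mono)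
  qed
  have "C-lipschitz_on {0..} (r i)"
  proof (rule bounded_derivative_imp_lipschitz)
    show "(r i has_derivative (\<lambda>h. h *\<^sub>R (\<Omega> i *v r i t + coupling i t))) (at t within {0..})"
      if "t \<in> {0..}" for t
      using deriv_r[of t i] that by (simp add: has_vector_derivative_def)
    show "0 \<le> C" using bound[of 0] norm_ge_zero order_trans by blast
    then show "onorm (\<lambda>h. h *\<^sub>R (\<Omega> i *v r i t + coupling i t)) \<le> C" if "t \<in> {0..}" for t
      using bound[of t] that by (intro onorm_bound) (auto simp: mult.commute[of C] mult_left_mono)
  qed simp
  then show ?thesis by (rule lipschitz_on_uniformly_continuous)
qed

section \<open>Lyapunov function and phase synchronization\<close>

lemma edge_synchronization:
  assumes p: "p \<in> common_power_space \<Omega>" and pos: "\<And>i. p \<bullet> r i 0 > 0"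
    and edge: "(j, i) \<in> E"
  shows "((\<lambda>t. r i t - r j t) \<longlongrightarrow> 0) at_top"
proof -
  obtain u where u0: "u 0 = p"
    and du: "\<And>t. (u has_vector_derivative \<Omega> i *v u t) (at t)"
    and ker: "\<And>N :: real ^ 'n ^ 'n. \<And>t. (\<And>l. N *v (matpow (\<Omega> i) l *v p) = 0) \<Longrightarrow> N *v u t = 0"
    using linear_flow_exists[of p "\<Omega> i"] by metis
  \<comment> \<open>The frame \<open>u\<close> is generated by \<open>\<Omega> i\<close> alone; here
    it is seen to solve the linear equation of every oscillator.\<close>
  have common: "\<Omega> a *v u t = \<Omega> i *v u t" for a t
  proof -
    have "(\<Omega> a - \<Omega> i) *v u t = 0"
    proof (rule ker)
      fix l
      have "\<Omega> a *v (matpow (\<Omega> i) l *v p) = matpow (\<Omega> a) (Suc l) *v p"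
        using common_power_space_matpow_eq[OF p, of i l a]
        by (simp add: matpow_Suc_mult_vector del: matpow.simps)
      also have "\<dots> = \<Omega> i *v (matpow (\<Omega> i) l *v p)"
        using common_power_space_matpow_eq[OF p, of a "Suc l" i]
        by (simp add: matpow_Suc_mult_vector del: matpow.simps)
      finally show "(\<Omega> a - \<Omega> i) *v (matpow (\<Omega> i) l *v p) = 0"
        by (simp add: matrix_vector_mult_diff_rdistrib)
    qed
    then show ?thesis by (simp add: matrix_vector_mult_diff_rdistrib)
  qed
  have norm_u: "norm (u t) = norm p" for t
  proof -
    have "((\<lambda>t. u t \<bullet> u t) has_real_derivative 0) (at t)" for t
    proof -
      have "u t \<bullet> (\<Omega> i *v u t) + (\<Omega> i *v u t) \<bullet> u t = 0"
        by (simp add: skew_symmetric_inner[OF skew])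
      then show ?thesis
        using bounded_bilinear.has_vector_derivative[OF bounded_bilinear_inner du[of t] du[of t]]
        by (simp only: has_real_derivative_iff_has_vector_derivative)
    qed
    then have "u t \<bullet> u t = u 0 \<bullet> u 0"
      by (intro DERIV_isconst_all[of "\<lambda>t. u t \<bullet> u t"]) auto
    then show ?thesis by (simp add: u0 norm_eq)
  qed
  define x where "x a t = u t \<bullet> r a t" for a t
  have dx: "(x a has_real_derivative
      k * (\<Sum>b\<in>UNIV. A $ a $ b * (x b t - (r a t \<bullet> r b t) * x a t))) (at t within {0..})"
    if "0 \<le> t" for a t
  proof -
    have "(x a has_real_derivative u t \<bullet> (\<Omega> a *v r a t + coupling a t) + (\<Omega> i *v u t) \<bullet> r a t)
        (at t within {0..})"
      using bounded_bilinear.has_vector_derivative[OF bounded_bilinear_inner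
          has_vector_derivative_at_within[OF du] deriv_r[OF that], of a]
      by (simp add: has_real_derivative_iff_has_vector_derivative x_def[abs_def])
    \<comment> \<open>The two rotation terms cancel because frame and oscillator turn with the same
      skew-symmetric matrix along \<open>u\<close>.\<close>
    moreover have "u t \<bullet> (\<Omega> a *v r a t) = - ((\<Omega> i *v u t) \<bullet> r a t)"
      by (simp add: skew_symmetric_inner[OF skew] common[of a])
    moreover have "u t \<bullet> coupling a t =
        k * (\<Sum>b\<in>UNIV. A $ a $ b * (x b t - (r a t \<bullet> r b t) * x a t))"
      by (simp add: coupling_def inner_sum_right inner_diff_right x_def)
    ultimately show ?thesis by (simp add: inner_add_right)
  qed
  have x_pos: "0 < x a t" if "0 \<le> t" for a t
  proof (rule cooperative_linear_system_pos[where x = x and b = "\<lambda>a b. k * A $ a $ b"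
        and c = "\<lambda>a t. k * (\<Sum>b\<in>UNIV. A $ a $ b * (r a t \<bullet> r b t))"
        and C = "\<Sum>a\<in>UNIV. k * (\<Sum>b\<in>UNIV. A $ a $ b)"])
    show "(x a has_real_derivative (\<Sum>b\<in>UNIV. k * A $ a $ b * x b t) -
        k * (\<Sum>b\<in>UNIV. A $ a $ b * (r a t \<bullet> r b t)) * x a t) (at t within {0..})"
      if "0 \<le> t" for a t
      using dx[OF that, of a]
      by (simp add: right_diff_distrib sum_subtractf sum_distrib_left sum_distrib_right mult.assoc)
    fix a and t :: real assume "0 \<le> t"
    have "k * (\<Sum>b\<in>UNIV. A $ a $ b * (r a t \<bullet> r b t)) \<le> k * (\<Sum>b\<in>UNIV. A $ a $ b)"
      using k_pos A_nonneg inner_r_le[OF \<open>0 \<le> t\<close>]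
      by (intro mult_left_mono sum_mono mult_left_le) (auto simp: abs_le_iff)
    also have "\<dots> \<le> (\<Sum>a\<in>UNIV. k * (\<Sum>b\<in>UNIV. A $ a $ b))"
      using k_pos A_nonneg by (intro member_le_sum) (auto intro!: mult_nonneg_nonneg sum_nonneg)
    finally show "k * (\<Sum>b\<in>UNIV. A $ a $ b * (r a t \<bullet> r b t)) \<le>
        (\<Sum>a\<in>UNIV. k * (\<Sum>b\<in>UNIV. A $ a $ b))" .
  qed (use pos k_pos A_nonneg that in \<open>auto simp: x_def u0\<close>)
  have x_le: "x a t \<le> norm p" if "0 \<le> t" for a t
    using norm_cauchy_schwarz[of "u t" "r a t"] that by (simp add: x_def norm_u norm_r)
  obtain w where w_pos: "\<And>i. 0 < w i"
    and w: "\<And>j. (\<Sum>i\<in>UNIV. w i * A $ i $ j) = w j * (\<Sum>i\<in>UNIV. A $ j $ i)"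
    using laplacian_positive_left_null_vector[OF adj strong] by metis
  define L where "L t = (\<Sum>a\<in>UNIV. w a * ln (x a t))" for t
  define L' where
    "L' t = k * (\<Sum>a\<in>UNIV. \<Sum>b\<in>UNIV. w a * A $ a $ b * (x b t / x a t - r a t \<bullet> r b t))" for t
  have dL: "(L has_real_derivative L' t) (at t within {0..})" if "0 \<le> t" for t
  proof -
    have "(L has_real_derivative (\<Sum>a\<in>UNIV. w a *
        ((1 / x a t) * (k * (\<Sum>b\<in>UNIV. A $ a $ b * (x b t - (r a t \<bullet> r b t) * x a t))))))
        (at t within {0..})"
      unfolding L_def[abs_def]
      by (intro DERIV_sum DERIV_cmult DERIV_chain2[OF DERIV_ln_divide] dx x_pos that)
    moreover have "w a * ((1 / x a t) * (k * (\<Sum>b\<in>UNIV. A $ a $ b * (x b t - (r a t \<bullet> r b t) * x a t)))) =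
        k * (\<Sum>b\<in>UNIV. w a * A $ a $ b * (x b t / x a t - r a t \<bullet> r b t))" for a
      using x_pos[OF that, of a] by (simp add: sum_distrib_left field_simps)
    ultimately show ?thesis
      by (simp add: L'_def sum_distrib_left)
  qed
  \<comment> \<open>All terms \<open>q a b\<close> are nonnegative, so the whole sum dominates the
    single term of the given edge.\<close>
  have L'_ge: "k * w i * A $ i $ j / 2 * (norm (r i t - r j t))\<^sup>2 \<le> L' t" if "0 \<le> t" for t
  proof -
    define q where "q a b = w a * A $ a $ b * ((norm (r a t - r b t))\<^sup>2 / 2)" for a b
    have q_nonneg: "0 \<le> q a b" for a b
      using w_pos[of a] A_nonneg by (simp add: q_def)
    have "w i * A $ i $ j * ((norm (r i t - r j t))\<^sup>2 / 2) \<le> (\<Sum>b\<in>UNIV. q i b)"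
      using member_le_sum[of j UNIV "q i"] q_nonneg by (simp add: q_def)
    also have "\<dots> \<le> (\<Sum>a\<in>UNIV. \<Sum>b\<in>UNIV. q a b)"
      by (intro member_le_sum) (auto intro!: sum_nonneg q_nonneg)
    \<comment> \<open>The inserted logarithms sum to \<open>0\<close>: by the choice of
      \<open>w\<close>, weighted column sums equal weighted row sums.\<close>
    also have "\<dots> = (\<Sum>a\<in>UNIV. \<Sum>b\<in>UNIV. w a * A $ a $ b * (ln (x b t) - ln (x a t)) + q a b)"
    proof -
      have "(\<Sum>a\<in>UNIV. \<Sum>b\<in>UNIV. w a * A $ a $ b * ln (x b t)) =
          (\<Sum>b\<in>UNIV. (\<Sum>a\<in>UNIV. w a * A $ a $ b) * ln (x b t))"
        by (subst sum.swap) (simp add: sum_distrib_right)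
      also have "\<dots> = (\<Sum>a\<in>UNIV. \<Sum>b\<in>UNIV. w a * A $ a $ b * ln (x a t))"
        by (simp add: w sum_distrib_left sum_distrib_right)
      finally show ?thesis
        by (simp add: sum.distrib right_diff_distrib sum_subtractf)
    qed
    also have "\<dots> \<le> (\<Sum>a\<in>UNIV. \<Sum>b\<in>UNIV. w a * A $ a $ b * (x b t / x a t - r a t \<bullet> r b t))"
    proof (intro sum_mono)
      fix a b
      have "(norm (r a t - r b t))\<^sup>2 / 2 = 1 - r a t \<bullet> r b t"
        using norm_r[OF that, of a] norm_r[OF that, of b]
        by (simp add: power2_norm_eq_inner inner_diff inner_commute norm_eq_1)
      moreover have "ln (x b t) - ln (x a t) \<le> x b t / x a t - 1"
        using ln_diff_le[of "x b t" "x a t"] x_pos[OF that, of a] x_pos[OF that, of b]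
        by (simp add: diff_divide_distrib)
      ultimately have "ln (x b t) - ln (x a t) + (norm (r a t - r b t))\<^sup>2 / 2 \<le>
          x b t / x a t - r a t \<bullet> r b t"
        by linarith
      then have "w a * A $ a $ b * (ln (x b t) - ln (x a t) + (norm (r a t - r b t))\<^sup>2 / 2) \<le>
          w a * A $ a $ b * (x b t / x a t - r a t \<bullet> r b t)"
        using w_pos[of a] A_nonneg by (intro mult_left_mono) auto
      then show "w a * A $ a $ b * (ln (x b t) - ln (x a t)) + q a b \<le>
          w a * A $ a $ b * (x b t / x a t - r a t \<bullet> r b t)"
        by (simp add: q_def distrib_left)
    qed
    finally show ?thesis
      using k_pos unfolding L'_def by (simp add: mult.assoc mult_left_mono)
  qed
  define \<gamma> where "\<gamma> = k * w i * A $ i $ j / 2"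
  have "\<gamma> > 0"
    using k_pos w_pos[of i] edge adj by (simp add: \<gamma>_def weighted_adjacency_matrix_def)
  obtain l where l: "(L \<longlongrightarrow> l) at_top"
  proof (rule mono_bounded_tendsto_at_top)
    show "L s \<le> L t" if "0 \<le> s" "s \<le> t" for s t
    proof (rule has_real_derivative_nonneg_imp_le[where f' = L', OF that dL])
      show "0 \<le> L' \<tau>" if "s < \<tau>" "\<tau> < t" for \<tau>
        using L'_ge[of \<tau>] that \<open>0 \<le> s\<close> \<open>\<gamma> > 0\<close>
        by (intro order_trans[OF _ L'_ge]) (auto simp flip: \<gamma>_def)
    qed
    show "L t \<le> (\<Sum>a\<in>UNIV. w a * ln (norm p))" if "0 \<le> t" for t
      unfolding L_def
    proof (intro sum_mono mult_left_mono)
      show "ln (x a t) \<le> ln (norm p)" for a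
        using x_pos[OF that, of a] x_le[OF that, of a] by (subst ln_le_cancel_iff) auto
    qed (use w_pos less_imp_le in auto)
  qed
  \<comment> \<open>The squared norm is uniformly continuous on bounded sets, and differences of
    unit vectors stay in the ball of radius \<open>2\<close>.\<close>
  have uc: "uniformly_continuous_on {0..} (\<lambda>t. \<gamma> * (norm (r i t - r j t))\<^sup>2)"
  proof (rule uniformly_continuous_on_compose[where f = "\<lambda>y. \<gamma> * (norm y)\<^sup>2"])
    show "uniformly_continuous_on {0..} (\<lambda>t. r i t - r j t)"
      by (intro uniformly_continuous_on_diff uniformly_continuous_on_r)
    have "norm (r i t - r j t) \<le> 2" if "0 \<le> t" for t
      using norm_triangle_ineq4[of "r i t" "r j t"] that by (simp add: norm_r)
    then have "(\<lambda>t. r i t - r j t) ` {0..} \<subseteq> cball 0 2" by auto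
    moreover have "uniformly_continuous_on (cball 0 2) (\<lambda>y :: real ^ 'n. \<gamma> * (norm y)\<^sup>2)"
      by (intro compact_uniformly_continuous continuous_intros compact_cball)
    ultimately show "uniformly_continuous_on ((\<lambda>t. r i t - r j t) ` {0..}) (\<lambda>y. \<gamma> * (norm y)\<^sup>2)"
      unfolding uniformly_continuous_on_def by (meson subsetD)
  qed
  show ?thesis
  proof (rule tendstoI)
    fix \<epsilon> :: real assume "0 < \<epsilon>"
    have "\<forall>\<^sub>F t in at_top. \<gamma> * (norm (r i t - r j t))\<^sup>2 < \<gamma> * \<epsilon>\<^sup>2"
      by (rule barbalat_eventually_less[OF l dL _ tendsto_const uc])
        (use L'_ge \<open>\<gamma> > 0\<close> \<open>0 < \<epsilon>\<close> in \<open>auto simp: \<gamma>_def\<close>)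
    then show "\<forall>\<^sub>F t in at_top. dist (r i t - r j t) 0 < \<epsilon>"
    proof eventually_elim
      case (elim t)
      then have "(norm (r i t - r j t))\<^sup>2 < \<epsilon>\<^sup>2"
        using \<open>\<gamma> > 0\<close> by simp
      then show ?case
        using power2_less_imp_less[of "norm (r i t - r j t)" \<epsilon>] \<open>0 < \<epsilon>\<close> by simp
    qed
  qed
qed

text \<open>The differences along the edges of a directed path from \<open>j\<close> to
  \<open>i\<close> telescope.\<close>

lemma synchronization:
  assumes p: "p \<in> common_power_space \<Omega>" and pos: "\<And>i. p \<bullet> r i 0 > 0"
  shows "((\<lambda>t. r i t - r j t) \<longlongrightarrow> 0) at_top"
proof -
  have "(j, i) \<in> E\<^sup>*"
    using strong by (simp add: strongly_connected_digraph_def)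
  then show ?thesis
  proof induction
    case (step y z)
    then show ?case
      using tendsto_add[OF edge_synchronization[OF p pos step(2)] step(3)] by simp
  qed simp
qed

section \<open>Convergence to the common power space\<close>

context
  assumes sync: "\<And>i j. ((\<lambda>t. r i t - r j t) \<longlongrightarrow> 0) at_top"
begin

lemma coupling_tendsto_zero: "(coupling i \<longlongrightarrow> 0) at_top"
proof -
  have "((\<lambda>t. r j t - (r i t \<bullet> r j t) *\<^sub>R r i t) \<longlongrightarrow> 0) at_top" for j
  proof (rule Lim_null_comparison)
    show "\<forall>\<^sub>F t in at_top. norm (r j t - (r i t \<bullet> r j t) *\<^sub>R r i t) \<le>
        norm (r i t - r j t) + (norm (r i t - r j t))\<^sup>2 / 2"
      using eventually_ge_at_top[of 0]
      by eventually_elim (rule norm_sub_inner_scaleR_le; simp add: norm_r)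
    show "((\<lambda>t. norm (r i t - r j t) + (norm (r i t - r j t))\<^sup>2 / 2) \<longlongrightarrow> 0) at_top"
      by (rule tendsto_eq_intros sync refl | simp)+
  qed
  then have "((\<lambda>t. k *\<^sub>R (\<Sum>j\<in>UNIV. A $ i $ j *\<^sub>R (r j t - (r i t \<bullet> r j t) *\<^sub>R r i t))) \<longlongrightarrow>
      k *\<^sub>R (\<Sum>j\<in>UNIV. A $ i $ j *\<^sub>R 0)) at_top"
    by (intro tendsto_intros)
  then show ?thesis by (simp add: coupling_def[abs_def])
qed

text \<open>Differentiating \<open>matpow (\<Omega> i) l *v r i t\<close> raises the power by one,
  up to a coupling term that tends to \<open>0\<close>. So Barbalat's lemma carries the limit from
  \<open>l\<close> to \<open>Suc l\<close>, coordinate by coordinate.\<close>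

lemma matpow_synchronization:
  "((\<lambda>t. matpow (\<Omega> i) l *v r i t - matpow (\<Omega> j) l *v r j t) \<longlongrightarrow> 0) at_top"
proof (induction l)
  case 0
  then show ?case using sync by simp
next
  case (Suc l)
  let ?P = "\<lambda>i t. matpow (\<Omega> i) l *v r i t" and ?Q = "\<lambda>i t. matpow (\<Omega> i) (Suc l) *v r i t"
  let ?e = "\<lambda>t. matpow (\<Omega> i) l *v coupling i t - matpow (\<Omega> j) l *v coupling j t"
  have dP: "(?P i has_vector_derivative ?Q i t + matpow (\<Omega> i) l *v coupling i t) (at t within {0..})"
    if "0 \<le> t" for i t
    using bounded_linear.has_vector_derivative[OF matrix_vector_mul_bounded_linear deriv_r[OF that],
        of "matpow (\<Omega> i) l" i]
    by (simp add: matrix_vector_right_distrib matpow_commute matpow_Suc_mult_vector del: matpow.simps)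
  have e: "(?e \<longlongrightarrow> 0) at_top"
    using tendsto_diff[OF
        bounded_linear.tendsto[OF matrix_vector_mul_bounded_linear coupling_tendsto_zero]
        bounded_linear.tendsto[OF matrix_vector_mul_bounded_linear coupling_tendsto_zero]]
    by simp
  have uc: "uniformly_continuous_on {0..} (\<lambda>t. ?Q i t - ?Q j t)"
    by (intro uniformly_continuous_on_diff uniformly_continuous_on_r
        bounded_linear.uniformly_continuous_on[OF matrix_vector_mul_bounded_linear])
  show ?case
  proof (rule vec_tendstoI)
    fix a
    show "((\<lambda>t. (?Q i t - ?Q j t) $ a) \<longlongrightarrow> 0 $ a) at_top"
      unfolding zero_index
    proof (rule barbalat_tendsto_zero)
      show "((\<lambda>t. (?P i t - ?P j t) $ a) \<longlongrightarrow> 0 $ a) at_top" "((\<lambda>t. ?e t $ a) \<longlongrightarrow> 0) at_top"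
        using tendsto_vec_nth[OF Suc] tendsto_vec_nth[OF e] by simp_all
      show "uniformly_continuous_on {0..} (\<lambda>t. (?Q i t - ?Q j t) $ a)"
        by (rule bounded_linear.uniformly_continuous_on[OF bounded_linear_vec_nth uc])
      show "((\<lambda>t. (?P i t - ?P j t) $ a) has_real_derivative (?Q i t - ?Q j t) $ a + ?e t $ a)
          (at t within {0..})" if "0 \<le> t" for t
        using bounded_linear.has_vector_derivative[OF bounded_linear_vec_nth
            has_vector_derivative_diff[OF dP[OF that, of i] dP[OF that, of j]], of a]
        by (simp add: has_real_derivative_iff_has_vector_derivative algebra_simps del: matpow.simps)
    qed
  qed
qed

text \<open>The function \<open>G\<close> measures the failure of the defining equations of the
  space, so on the sphere its zeros lie in the space; it tends to \<open>0\<close> along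
  \<open>r a\<close>.\<close>

lemma approaches_common_power_space: "approaches (r a) (common_power_space \<Omega>)"
proof -
  let ?d = "\<lambda>l i j x. norm (matpow (\<Omega> i) l *v x - matpow (\<Omega> j) l *v x)"
  define G where "G x = (\<Sum>l\<in>{1..CARD('n)}. \<Sum>i\<in>UNIV. \<Sum>j\<in>UNIV. ?d l i j x)" for x
  have "((\<lambda>t. infdist (r a t) (common_power_space \<Omega>)) \<longlongrightarrow> 0) at_top"
  proof (rule infdist_zero_set_tendsto_zero[where G = G])
    show "compact (sphere (0 :: real ^ 'n) 1)" by (rule compact_sphere)
    show "continuous_on (sphere 0 1) G"
      unfolding G_def
      by (intro continuous_intros linear_continuous_on matrix_vector_mul_bounded_linear)
    show "0 \<le> G x" for x
      by (simp add: G_def sum_nonneg)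
    show "x \<in> common_power_space \<Omega>" if "G x = 0" for x
      using that by (simp add: G_def sum_nonneg_eq_0_iff sum_nonneg common_power_space_def)
    show "\<forall>\<^sub>F t in at_top. r a t \<in> sphere 0 1"
      using eventually_ge_at_top[of 0] by eventually_elim (simp add: norm_r)
    \<comment> \<open>Synchronization allows \<open>r i\<close> and \<open>r j\<close> to be
      replaced by the common argument \<open>r a\<close> at a vanishing cost.\<close>
    have "((\<lambda>t. matpow (\<Omega> i) l *v r a t - matpow (\<Omega> j) l *v r a t) \<longlongrightarrow> 0) at_top" for i j l
    proof -
      have *: "((\<lambda>t. matpow (\<Omega> b) l *v (r a t - r b t)) \<longlongrightarrow> 0) at_top" for b
        using bounded_linear.tendsto[OF matrix_vector_mul_bounded_linear sync] by fastforce
      show ?thesis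
        using tendsto_diff[OF tendsto_add[OF *[of i] matpow_synchronization[of i l j]] *[of j]]
        by (simp add: matrix_vector_mult_diff_distrib)
    qed
    then have "((\<lambda>t. G (r a t)) \<longlongrightarrow> (\<Sum>l\<in>{1..CARD('n)}. \<Sum>i\<in>(UNIV :: 'm set). \<Sum>j\<in>(UNIV :: 'm set). 0)) at_top"
      unfolding G_def by (intro tendsto_sum tendsto_norm_zero)
    then show "((\<lambda>t. G (r a t)) \<longlongrightarrow> 0) at_top" by simp
  qed
  then show ?thesis by (simp add: approaches_def)
qed

end

end

theorem theorem2:
  fixes \<Omega> :: "'m::finite \<Rightarrow> real ^ 'n ^ 'n"
    and k :: real
    and E :: "('m \<times> 'm) set"
    and A :: "real ^ 'm ^ 'm"
    and r :: "'m \<Rightarrow> real \<Rightarrow> real ^ 'n"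
    and p :: "real ^ 'n"
  assumes "\<And>i. skew_symmetric (\<Omega> i)"
    and "\<exists>i j. \<Omega> i \<noteq> \<Omega> j"
    and "k > 0"
    and "weighted_adjacency_matrix E A"
    and "dim (common_power_space \<Omega>) > 0"
    and "strongly_connected_digraph E"
    and "kuramoto_solution \<Omega> k A r"
    and "p \<in> common_power_space \<Omega>"
    and "\<And>i. p \<bullet> r i 0 > 0"
  shows "complete_phase_synchronization r \<and> (\<forall>i. approaches (r i) (common_power_space \<Omega>))"
proof -
  interpret kuramoto \<Omega> k E A r
    by unfold_locales (rule assms)+
  have sync: "((\<lambda>t. r i t - r j t) \<longlongrightarrow> 0) at_top" for i j
    by (rule synchronization[OF assms(8,9)])
  then show ?thesis
    using approaches_common_power_space[OF sync]
    by (simp add: complete_phase_synchronization_def)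
qed

end
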